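(* Let $A$ be a finite set of $k \geq 3$ positive integers, let $r$ be a positive integer, and let $H=\{h_1,\ldots,h_t\}$ with $h_1<h_2<\cdots<h_t$ be a set of $t \geq 2$ positive integers such that $1 \leq r \leq \max(H) \leq (k-1)r-1$. Then \[ |H^{(r)}A| \geq \mathcal{L}_k(H,r). \] Moreover, this lower bound is best possible: there exist such sets $A$ and $H$ for which equality holds.
   Context: For a finite set $A=\{a_1,\ldots,a_k\}$ of integers and positive integers $h, r$, the generalized $h$-fold sumset is $h^{(r)}A=\{\sum_{i=1}^k \lambda_i a_i : 0\le \lambda_i\le r,\ \sum_{i=1}^k\lambda_i=h\}$, i.e. the set of sums of $h$ elements of $A$ in which each element is used at most $r$ times. For a finite set $H$ of positive integers, $H^{(r)}A=\bigcup_{h\in H} h^{(r)}A$. For a set $H=\{h_1<\cdots<h_t\}$ of positive integers, a positive integer $r$ and an integer $k$, put $h_0=0$ and, for $0\le i\le t$, write $h_i=m_i r+\epsilon_i$ with $m_i=\lfloor h_i/r\rfloor$ and $0\le \epsilon_i\le r-1$. Define \[\mathcal{L}_k(H,r)=\sum_{i=1}^{t}\Big( r(m_i-m_{i-1})(k-m_i)+(\epsilon_i-\epsilon_{i-1})(k-m_i-1)-\max\{\epsilon_i,\epsilon_{i-1}\}(m_i-m_{i-1})+1\Big).\] *)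

theory Defs
  imports Complex_Main
begin

definition gen_sumset :: "nat \<Rightarrow> nat \<Rightarrow> int set \<Rightarrow> int set" where
  "gen_sumset r h A =
     {(\<Sum>a\<in>A. int (l a) * a) | l :: int \<Rightarrow> nat. (\<forall>a\<in>A. l a \<le> r) \<and> (\<Sum>a\<in>A. l a) = h}"

definition gen_sumset_Union :: "nat \<Rightarrow> nat set \<Rightarrow> int set \<Rightarrow> int set" where
  "gen_sumset_Union r H A = (\<Union>h\<in>H. gen_sumset r h A)"

(* For finite H = {h_1 < ... < h_t}: the value is h_i for 1 <= i <= t, and h_0 = 0. *)
definition hseq :: "nat set \<Rightarrow> nat \<Rightarrow> nat" where
  "hseq H i = (0 # sorted_list_of_set H) ! i"

definition mquot :: "nat set \<Rightarrow> nat \<Rightarrow> nat \<Rightarrow> int" where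
  "mquot H r i = int (hseq H i div r)"

definition erem :: "nat set \<Rightarrow> nat \<Rightarrow> nat \<Rightarrow> int" where
  "erem H r i = int (hseq H i mod r)"

definition lower_bound :: "int \<Rightarrow> nat set \<Rightarrow> nat \<Rightarrow> int" where
  "lower_bound k H r =
     (\<Sum>i = 1..card H.
        int r * (mquot H r i - mquot H r (i - 1)) * (k - mquot H r i)
        + (erem H r i - erem H r (i - 1)) * (k - mquot H r i - 1)
        - max (erem H r i) (erem H r (i - 1)) * (mquot H r i - mquot H r (i - 1))
        + 1)"

definition admissible :: "nat \<Rightarrow> nat \<Rightarrow> nat \<Rightarrow> int set \<Rightarrow> nat set \<Rightarrow> bool" where
  "admissible k r t A H \<longleftrightarrow>
     finite A \<and> card A = k \<and> (\<forall>a\<in>A. 0 < a) \<and>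
     finite H \<and> card H = t \<and> (\<forall>h\<in>H. 0 < h) \<and>
     r \<le> Max H \<and> int (Max H) \<le> (int k - 1) * int r - 1"

end

theory Submission
  imports Defs
begin

text \<open>
  List \<open>A\<close> as \<open>a\<^sub>0 < \<dots> < a\<^sub>k\<^sub>-\<^sub>1\<close> and encode a sum of \<open>h\<close> elements by its
  multiplicities \<open>l\<^sub>j \<le> r\<close>.  Moving one unit of multiplicity from \<open>j\<close> to \<open>j + 1\<close> strictly
  increases the sum and raises the weight \<open>\<Sum>j l\<^sub>j\<close> by exactly one; the only multiplicities
  admitting no such move are the greedy top ones, of weight \<open>h (k - 1) - \<Sum>i<h. i div r\<close>.
  Hence multiplicities of low weight have many distinct sums above them.

  Given consecutive \<open>g < h\<close> in \<open>H\<close>, add to the top multiplicities for \<open>g\<close> the greedy bottom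
  ones for \<open>h - g\<close>; the bound on \<open>Max H\<close> keeps their supports disjoint.  Moving
  upwards from there yields elements exceeding every \<open>g\<close>-fold sum, and their number is
  at least the summand of the bound belonging to \<open>h\<close>.  For \<open>A = {1..k}\<close> and \<open>H\<close> an
  interval the bound telescopes to the length of the interval that contains all sums.
\<close>

section \<open>Multiplicity vectors, weighted sums and the extremal weight term\<close>

definition configs :: "nat \<Rightarrow> nat \<Rightarrow> nat \<Rightarrow> (nat \<Rightarrow> nat) set" where
  "configs k r h = {l. (\<forall>j<k. l j \<le> r) \<and> (\<Sum>j<k. l j) = h}"

definition wsum :: "nat \<Rightarrow> (nat \<Rightarrow> int) \<Rightarrow> (nat \<Rightarrow> nat) \<Rightarrow> int" where
  "wsum k a l = (\<Sum>j<k. int (l j) * a j)"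

definition config_sums :: "nat \<Rightarrow> nat \<Rightarrow> (nat \<Rightarrow> int) \<Rightarrow> nat \<Rightarrow> int set" where
  "config_sums k r a h = wsum k a ` configs k r h"

text \<open>Least weight of \<open>h\<close> units: packed from position 0 upwards with
  \<open>r\<close> units per position, unit \<open>i\<close> lands on position
  \<open>i div r\<close>.\<close>

definition divsum :: "nat \<Rightarrow> nat \<Rightarrow> nat" where
  "divsum r h = (\<Sum>i<h. i div r)"

lemma divsum_simps [simp]: "divsum r 0 = 0" "divsum r (Suc h) = divsum r h + h div r"
  by (simp_all add: divsum_def)

lemma divsum_eq_0: "h \<le> r \<Longrightarrow> divsum r h = 0"
  by (simp add: divsum_def)

text \<open>The indices below \<open>r\<close> contribute 0, and each index \<open>r + i\<close> has
  a quotient one larger than that of \<open>i\<close>.\<close>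

lemma divsum_add: "0 < r \<Longrightarrow> divsum r (r + h) = divsum r h + h"
  by (induction h) (simp_all add: divsum_eq_0)

text \<open>Splitting off \<open>r\<close> units lowers the quotient by one and keeps the remainder.
  Doubling avoids a division by 2.\<close>

lemma divsum_closed:
  assumes "0 < r"
  shows "2 * int (divsum r h) = int r * int (h div r) * (int (h div r) - 1)
           + 2 * int (h div r) * int (h mod r)"
proof (induction h rule: less_induct)
  case (less h)
  show ?case
  proof (cases "h < r")
    case True
    then show ?thesis by (simp add: divsum_eq_0)
  next
    case False
    define g where "g = h - r"
    have h: "h = r + g" using False by (simp add: g_def)
    have g: "int g = int r * int (g div r) + int (g mod r)"
      by (metis mult_div_mod_eq of_nat_add of_nat_mult)
    have "2 * int (divsum r h) = 2 * int (divsum r g) + 2 * int g"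
      by (simp add: h divsum_add assms)
    also have "2 * int (divsum r g) = int r * int (g div r) * (int (g div r) - 1)
           + 2 * int (g div r) * int (g mod r)"
      using less[of g] assms h by simp
    finally show ?thesis
      using assms unfolding g by (simp add: h algebra_simps)
  qed
qed

section \<open>Upward moves and extremal configurations\<close>

lemma wsum_pos:
  assumes "\<And>j. j < k \<Longrightarrow> 0 < a j" and "b \<in> configs k r d" and "0 < d"
  shows "0 < wsum k a b"
proof -
  obtain j where j: "j < k" "b j \<noteq> 0"
    using assms(2,3) unfolding configs_def
    by (metis (mono_tags, lifting) lessThan_iff mem_Collect_eq not_gr_zero sum.neutral)
  show ?thesis
    unfolding wsum_def using assms(1) j
    by (intro sum_pos2[of _ j]) (auto simp: less_imp_le)
qed

lemma finite_config_sums: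
  assumes "\<And>j. j < k \<Longrightarrow> 0 < a j"
  shows "finite (config_sums k r a h)"
proof (rule finite_subset)
  show "config_sums k r a h \<subseteq> {0..\<Sum>j<k. int r * a j}"
    using assms
    by (force simp: config_sums_def configs_def wsum_def less_imp_le
        intro!: sum_nonneg sum_mono mult_right_mono)
qed simp

text \<open>For \<open>a = int\<close> the change is exactly 1, so a move raises the weight by one;
  for increasing \<open>a\<close> it is positive.\<close>

lemma wsum_step:
  assumes "l \<in> configs k r h" "Suc j < k" "l j \<noteq> 0" "l (Suc j) < r"
  defines "l' \<equiv> l(j := l j - 1, Suc j := Suc (l (Suc j)))"
  shows "l' \<in> configs k r h" and "wsum k a l' = wsum k a l + a (Suc j) - a j"
proof -
  have split: "sum f {..<k} = f j + f (Suc j) + sum f ({..<k} - {j, Suc j})"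
    for f :: "nat \<Rightarrow> 'b::comm_monoid_add"
    using assms(2) by (subst sum.subset_diff[of "{j, Suc j}"]) (auto simp: add.commute)
  show "l' \<in> configs k r h"
    using assms(1-4) unfolding configs_def l'_def mem_Collect_eq split[of l]
    by (subst split) (auto intro: le_trans[OF diff_le_self])
  show "wsum k a l' = wsum k a l + a (Suc j) - a j"
    using assms(3) unfolding wsum_def l'_def split
    by (simp add: algebra_simps of_nat_diff)
qed

text \<open>Induction on the number of positions, inspecting the last one: either it is not full and
  everything below it is empty, or it holds \<open>r\<close> units and the remaining positions form
  a stuck configuration of \<open>h - r\<close> units.\<close>

lemma stuck_config:
  assumes "0 < r" and "l \<in> configs k r h"
    and "\<And>j. Suc j < k \<Longrightarrow> l j = 0 \<or> r \<le> l (Suc j)"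
  shows "wsum k int l = int h * (int k - 1) - int (divsum r h)
         \<and> (\<forall>j. j + h div r + 1 < k \<longrightarrow> l j = 0)"
  using assms(2,3)
proof (induction k arbitrary: h)
  case 0
  then have "h = 0" by (simp add: configs_def split: if_splits)
  then show ?case by (simp add: wsum_def)
next
  case (Suc k)
  note nomove = Suc.prems(2)
  show ?case
  proof (cases "l k < r")
    case True
    \<comment> \<open>Downward propagation: below a position that is not full the absence of moves
      forces 0, which is again less than \<open>r\<close>.\<close>
    have "l (k - i) < r \<and> (0 < i \<longrightarrow> l (k - i) = 0)" if "i \<le> k" for i
      using that
    proof (induction i)
      case (Suc i)
      then show ?case
        using assms(1) nomove[of "k - Suc i"]
        by (auto simp: Suc_diff_Suc)
    qed (use True in simp)
    then have z: "l j = 0" if "j < k" for j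
      using that by (metis diff_diff_cancel diff_le_self less_imp_le zero_less_diff)
    then have "h = l k" using Suc.prems by (simp add: configs_def)
    then show ?thesis using True z by (simp add: wsum_def divsum_eq_0)
  next
    case False
    then have lk: "l k = r" and sub: "l \<in> configs k r (h - r)" and "r \<le> h"
      using Suc.prems(1) by (auto simp: configs_def)
    then obtain g where g: "h = r + g" using le_Suc_ex by blast
    from Suc.IH[OF sub] Suc.prems(2) g
    have IH: "wsum k int l = int g * (int k - 1) - int (divsum r g)"
      "\<forall>j. j + g div r + 1 < k \<longrightarrow> l j = 0" by auto
    have "wsum (Suc k) int l = wsum k int l + int r * int k"
      by (simp add: wsum_def lk)
    then show ?thesis using IH assms(1)
      by (auto simp: g divsum_add[OF assms(1)] distrib_left distrib_right left_diff_distrib right_diff_distrib)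
  qed
qed

text \<open>A single move serves every valuation \<open>a\<close> at once, so weight
  (\<open>a = int\<close>) and actual sum can be tracked together.\<close>

lemma config_cases:
  assumes "0 < r" and "l \<in> configs k r h"
  obtains "wsum k int l = int h * (int k - 1) - int (divsum r h)"
      "\<And>j. j + h div r + 1 < k \<Longrightarrow> l j = 0"
    | j l' where "Suc j < k" "l' \<in> configs k r h"
      "\<And>a. wsum k a l' = wsum k a l + a (Suc j) - a j"
proof (cases "\<forall>j. Suc j < k \<longrightarrow> l j = 0 \<or> r \<le> l (Suc j)")
  case True
  then show ?thesis using stuck_config[OF assms] that(1) by blast
next
  case False
  then obtain j where "Suc j < k" "l j \<noteq> 0" "l (Suc j) < r" by (auto simp: not_le)
  then show ?thesis using wsum_step[OF assms(2)] that(2) by blast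
qed

text \<open>A first upper bound on the weight; it guarantees that the natural-number measure in the
  inductions below really decreases along a move.\<close>

lemma wsum_int_le_crude:
  assumes "l \<in> configs k r h"
  shows "wsum k int l \<le> int h * int k"
proof -
  have "wsum k int l \<le> (\<Sum>j<k. int (l j) * int k)"
    unfolding wsum_def by (intro sum_mono mult_left_mono) auto
  also have "\<dots> = int h * int k"
    using assms by (simp add: configs_def flip: sum_distrib_right of_nat_sum)
  finally show ?thesis .
qed

text \<open>Climb by moves until none is possible; the weight only grows on the way and the final
  weight is known.\<close>

lemma wsum_int_le:
  assumes "0 < r" and "l \<in> configs k r h"
  shows "wsum k int l \<le> int h * (int k - 1) - int (divsum r h)"
  using assms(2)
proof (induction "nat (int h * int k - wsum k int l)" arbitrary: l rule: less_induct)
  case less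
  show ?case
    using assms(1) less.prems
  proof (cases rule: config_cases)
    case (2 j l')
    have "wsum k int l' \<le> int h * (int k - 1) - int (divsum r h)"
      using less.hyps[OF _ 2(2)] 2(3)[of int] wsum_int_le_crude[OF 2(2)] by simp
    then show ?thesis using 2(3)[of int] by simp
  qed simp
qed

text \<open>Reversing the positions turns the upper bound into a lower bound.\<close>

lemma wsum_int_ge:
  assumes "0 < r" and "l \<in> configs k r h"
  shows "int (divsum r h) \<le> wsum k int l"
proof -
  define l' where "l' j = l (k - Suc j)" for j
  have h: "(\<Sum>j<k. l j) = h" using assms(2) by (simp add: configs_def)
  have "(\<Sum>j<k. l' j) = h"
    unfolding l'_def using sum.nat_diff_reindex[of l k] h by simp
  moreover have "l' j \<le> r" if "j < k" for j
    using assms(2) that by (simp add: configs_def l'_def)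
  ultimately have "l' \<in> configs k r h" by (simp add: configs_def)
  note wsum_int_le[OF assms(1) this]
  moreover have "wsum k int l' = int h * (int k - 1) - wsum k int l"
  proof -
    have "wsum k int l' = (\<Sum>j<k. int (l j) * int (k - Suc j))"
      unfolding wsum_def
      by (subst sum.nat_diff_reindex[symmetric]) (auto simp: l'_def intro!: sum.cong)
    also have "\<dots> = (\<Sum>j<k. int (l j) * (int k - 1) - int (l j) * int j)"
      by (intro sum.cong) (auto simp: algebra_simps of_nat_diff)
    finally show ?thesis
      by (simp add: sum_subtractf wsum_def h flip: sum_distrib_right of_nat_sum)
  qed
  ultimately show ?thesis by simp
qed

text \<open>Each move up yields a strictly larger sum at the cost of one unit of weight, so a chain
  of moves to the top produces as many distinct sums as there is weight left, plus the starting
  one.\<close>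

lemma card_config_sums_above:
  assumes "0 < r" and "\<And>j. j < k \<Longrightarrow> 0 < a j"
    and mono: "\<And>j. Suc j < k \<Longrightarrow> a j < a (Suc j)"
    and "l \<in> configs k r h"
  shows "int h * (int k - 1) - int (divsum r h) - wsum k int l + 1
           \<le> int (card {x \<in> config_sums k r a h. wsum k a l \<le> x})"
  using assms(4)
proof (induction "nat (int h * int k - wsum k int l)" arbitrary: l rule: less_induct)
  case less
  let ?S = "\<lambda>l. {x \<in> config_sums k r a h. wsum k a l \<le> x}"
  have fin: "finite (?S l)" for l using finite_config_sums[OF assms(2)] by simp
  have self: "wsum k a l \<in> ?S l" using less.prems by (simp add: config_sums_def)
  then have pos: "card (?S l) > 0" using fin card_gt_0_iff by blast
  show ?case
    using assms(1) less.prems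
  proof (cases rule: config_cases)
    case 1
    then show ?thesis using pos by simp
  next
    case (2 j l')
    have lt: "wsum k a l < wsum k a l'" using 2(3)[of a] mono[OF 2(1)] by simp
    then have "?S l' \<subset> ?S l" using self by force
    then have "card (?S l') < card (?S l)" using fin by (rule psubset_card_mono[rotated])
    moreover have "int h * (int k - 1) - int (divsum r h) - wsum k int l' + 1 \<le> int (card (?S l'))"
      using less.hyps[OF _ 2(2)] 2(3)[of int] wsum_int_le_crude[OF 2(2)] by simp
    ultimately show ?thesis using 2(3)[of int] by simp
  qed
qed

section \<open>New sums between consecutive numbers of summands\<close>

text \<open>By truncated subtraction, \<open>min r (d - r * j)\<close> is the greedy filling from
  position 0: full positions, then the remainder, then zeros.\<close>

lemma bottom_config:
  assumes "0 < r" and "d \<le> r * n"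
  shows "(\<Sum>j<n. min r (d - r * j)) = d"
    and "(\<Sum>j<n. int (min r (d - r * j)) * int j) = int (divsum r d)"
proof -
  have "(\<Sum>j<m. min r (e - r * j)) = min e (r * m)" for m e
    by (induction m) (auto simp: min_def)
  then have s: "(\<Sum>j<m. min r (e - r * j)) = e" if "e \<le> r * m" for m e
    using that by simp
  show "(\<Sum>j<n. min r (d - r * j)) = d" using assms(2) by (rule s)
  show "(\<Sum>j<n. int (min r (d - r * j)) * int j) = int (divsum r d)"
    using assms(2)
  proof (induction n arbitrary: d)
    case (Suc n)
    have le: "d - r \<le> r * n" using Suc.prems by simp
    \<comment> \<open>Dropping position 0 leaves the greedy filling for \<open>d - r\<close>, with
      each of its units counted one position higher.\<close>
    have "(\<Sum>j<Suc n. int (min r (d - r * j)) * int j)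
        = (\<Sum>j<n. int (min r (d - r - r * j)) * int j + int (min r (d - r - r * j)))"
      by (subst sum.lessThan_Suc_shift) (simp add: algebra_simps)
    also have "\<dots> = int (divsum r (d - r)) + int (d - r)"
      using Suc.IH[OF le] s[OF le] by (simp add: sum.distrib del: of_nat_min flip: of_nat_sum)
    also have "\<dots> = int (divsum r d)"
    proof (cases "r \<le> d")
      case True
      then show ?thesis using divsum_add[OF assms(1), of "d - r"] by simp
    qed (simp add: divsum_eq_0)
    finally show ?case .
  qed simp
qed

lemma configs_nonempty:
  assumes "0 < r" and "h \<le> r * k"
  shows "configs k r h \<noteq> {}"
proof -
  have "(\<lambda>j. min r (h - r * j)) \<in> configs k r h"
    using bottom_config(1)[OF assms] by (simp add: configs_def)
  then show ?thesis by blast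
qed

text \<open>The count is the top weight for \<open>h\<close>, minus the top weight for
  \<open>g\<close> and the bottom weight for \<open>h - g\<close>, plus one: the climbing room above
  a configuration whose sum already exceeds all \<open>g\<close>-fold sums.\<close>

lemma card_config_sums_new:
  assumes "0 < r" and pos: "\<And>j. j < k \<Longrightarrow> 0 < a j"
    and mono: "\<And>j. Suc j < k \<Longrightarrow> a j < a (Suc j)"
    and "g < h" and "h \<le> r * (k - 1)"
  shows "Max (config_sums k r a g) < Max (config_sums k r a h)"
    and "int (h - g) * (int k - 1) - int (divsum r h) + int (divsum r g)
           - int (divsum r (h - g)) + 1
         \<le> int (card {x \<in> config_sums k r a h. Max (config_sums k r a g) < x})"
proof -
  have fin: "finite (config_sums k r a n)" for n by (rule finite_config_sums[OF pos])
  have "g \<le> r * k" using assms(4,5) by (meson diff_le_self le_trans less_imp_le mult_le_mono2)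
  then have "config_sums k r a g \<noteq> {}" using configs_nonempty[OF assms(1)] by (simp add: config_sums_def)
  then have "Max (config_sums k r a g) \<in> config_sums k r a g" using fin Max_in by blast
  then obtain l where l: "l \<in> configs k r g" and max: "Max (config_sums k r a g) = wsum k a l"
    by (auto simp: config_sums_def)
  \<comment> \<open>A configuration with maximal sum admits no move, since a move would increase the
    sum.\<close>
  have stuck: "wsum k int l = int g * (int k - 1) - int (divsum r g)
      \<and> (\<forall>j. j + g div r + 1 < k \<longrightarrow> l j = 0)"
    using assms(1) l
  proof (cases rule: config_cases)
    case (2 j l')
    have "wsum k a l' \<le> wsum k a l"
      using Max_ge[OF fin] 2(2) max by (metis imageI config_sums_def)
    then show ?thesis using 2(3)[of a] mono[OF 2(1)] by simp
  qed auto
  define d where "d = h - g"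
  define b where "b j = min r (d - r * j)" for j
  have "0 < d" using assms(4) by (simp add: d_def)
  have "d \<le> r * k" using assms(5) by (simp add: d_def)
      (meson diff_le_self le_trans mult_le_mono2)
  note bot = bottom_config[OF assms(1) this, folded b_def]
  have b: "b \<in> configs k r d" using bot(1) by (simp add: configs_def b_def)
  have disj: "l j = 0" if "b j \<noteq> 0" for j
  proof -
    have "r * j < d" using that by (auto simp: b_def)
    \<comment> \<open>Here \<open>r * j < h - g\<close> and \<open>r * (g div r) \<le> g\<close>, so
      \<open>h \<le> r * (k - 1)\<close> puts \<open>j\<close> below the at most
      \<open>g div r + 1\<close> top positions where \<open>l\<close> can be nonzero.\<close>
    then have "r * j + r * (g div r) < r * (k - 1)"
      using assms(4,5) times_div_less_eq_dividend[of r g] unfolding d_def by linarith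
    then have "j + g div r < k - 1" by (simp flip: distrib_left)
    then show ?thesis using stuck by simp
  qed
  define s where "s j = l j + b j" for j
  have ws: "wsum k c s = wsum k c l + wsum k c b" for c
    by (simp add: wsum_def s_def sum.distrib algebra_simps)
  have "s j \<le> r" if "j < k" for j
    using l disj[of j] that by (cases "b j = 0") (auto simp: s_def configs_def b_def)
  moreover have "(\<Sum>j<k. s j) = h"
    using l bot(1) assms(4) by (simp add: s_def sum.distrib configs_def d_def)
  ultimately have s: "s \<in> configs k r h" by (simp add: configs_def)
  have lt: "wsum k a l < wsum k a s"
    using wsum_pos[OF pos b \<open>0 < d\<close>] by (simp add: ws)
  have "wsum k a s \<le> Max (config_sums k r a h)" using s fin by (simp add: config_sums_def)
  with lt max show "Max (config_sums k r a g) < Max (config_sums k r a h)" by simp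
  have "int h * (int k - 1) - int (divsum r h) - wsum k int s + 1
      \<le> int (card {x \<in> config_sums k r a h. wsum k a s \<le> x})"
    by (rule card_config_sums_above[OF assms(1) _ _ s]) (fact pos mono)+
  also have "\<dots> \<le> int (card {x \<in> config_sums k r a h. Max (config_sums k r a g) < x})"
    using fin lt max by (auto intro!: card_mono)
  finally show "int (h - g) * (int k - 1) - int (divsum r h) + int (divsum r g)
           - int (divsum r (h - g)) + 1
         \<le> int (card {x \<in> config_sums k r a h. Max (config_sums k r a g) < x})"
    using stuck bot(2) assms(4)
    by (simp add: ws wsum_def[of k int b] d_def of_nat_diff algebra_simps)
qed

section \<open>Arithmetic of the summands of the bound\<close>

definition lb_term :: "int \<Rightarrow> nat \<Rightarrow> nat \<Rightarrow> nat \<Rightarrow> int" where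
  "lb_term k r g h =
     int r * (int (h div r) - int (g div r)) * (k - int (h div r))
     + (int (h mod r) - int (g mod r)) * (k - int (h div r) - 1)
     - max (int (h mod r)) (int (g mod r)) * (int (h div r) - int (g div r)) + 1"

lemma lower_bound_eq:
  "lower_bound k H r = (\<Sum>i=1..card H. lb_term k r (hseq H (i - 1)) (hseq H i))"
  by (simp add: lower_bound_def lb_term_def mquot_def erem_def)

text \<open>Compares the summand with the count in \<open>card_config_sums_new\<close>. They agree
  when \<open>h - g\<close> is computed without a borrow in the remainder; a borrow only makes the
  count larger or equal.\<close>

lemma lb_term_le:
  assumes "0 < r" and "g \<le> h"
  shows "lb_term k r g h \<le> int (h - g) * (k - 1) - int (divsum r h) + int (divsum r g)
           - int (divsum r (h - g)) + 1"
    and "g mod r \<le> h mod r \<Longrightarrow>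
         lb_term k r g h = int (h - g) * (k - 1) - int (divsum r h) + int (divsum r g)
           - int (divsum r (h - g)) + 1"
proof -
  define m e n f where "m = h div r" and "e = h mod r" and "n = g div r" and "f = g mod r"
  have h: "h = r * m + e" and g: "g = r * n + f" by (simp_all add: m_def e_def n_def f_def)
  have er: "e < r" "f < r" using assms(1) by (simp_all add: e_def f_def)
  have nm: "n \<le> m" using assms(2) by (simp add: n_def m_def div_le_mono)
  obtain D where D: "m = n + D" using nm le_Suc_ex by blast
  have cH: "2 * int (divsum r h) = int r * int m * (int m - 1) + 2 * int m * int e"
    using divsum_closed[OF assms(1), of h] by (simp add: m_def e_def)
  have cG: "2 * int (divsum r g) = int r * int n * (int n - 1) + 2 * int n * int f"
    using divsum_closed[OF assms(1), of g] by (simp add: n_def f_def)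
  have hg: "int (h - g) = int r * int D + int e - int f"
    using assms(2) by (simp add: of_nat_diff h g D algebra_simps)
  have T: "lb_term k r g h = int r * int D * (k - int m) + (int e - int f) * (k - int m - 1)
      - max (int e) (int f) * int D + 1"
    by (simp add: lb_term_def D flip: m_def e_def n_def f_def)
  let ?R = "int (h - g) * (k - 1) - int (divsum r h) + int (divsum r g) - int (divsum r (h - g)) + 1"
  have eq: "lb_term k r g h = ?R" if "f \<le> e"
  proof -
    have "h - g = r * D + (e - f)" using that by (simp add: h g D algebra_simps)
    moreover have "e - f < r" using er by simp
    ultimately have "(h - g) div r = D" "(h - g) mod r = e - f" by simp_all
    then have "2 * int (divsum r (h - g)) = int r * int D * (int D - 1) + 2 * int D * (int e - int f)"
      using divsum_closed[OF assms(1), of "h - g"] that by (simp add: of_nat_diff)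
    then have "2 * ?R = 2 * lb_term k r g h"
      using cH cG that unfolding T hg by (simp add: D algebra_simps)
    then show ?thesis by simp
  qed
  then show "g mod r \<le> h mod r \<Longrightarrow> lb_term k r g h = ?R" by (simp add: e_def f_def)
  show "lb_term k r g h \<le> ?R"
  proof (cases "f \<le> e")
    case True
    then show ?thesis using eq by simp
  next
    case False
    then have "D \<noteq> 0" using assms(2) by (intro notI) (simp add: h g D)
    then obtain C where C: "D = Suc C" using not0_implies_Suc by blast
    \<comment> \<open>The borrow: one block of \<open>r\<close> moves from the quotient difference
      \<open>D = Suc C\<close> to the remainder.\<close>
    have "int (h - g) = int (r * C + (r + e - f))"
      using hg er False by (simp add: C of_nat_diff algebra_simps)
    then have "h - g = r * C + (r + e - f)" by linarith
    moreover have "r + e - f < r" using er False by simp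
    ultimately have "(h - g) div r = C" "(h - g) mod r = r + e - f" by simp_all
    then have "2 * int (divsum r (h - g)) = int r * int C * (int C - 1)
        + 2 * int C * (int r + int e - int f)"
      using divsum_closed[OF assms(1), of "h - g"] er False by (simp add: of_nat_diff)
    \<comment> \<open>The exact slack is \<open>C * (f - e)\<close>, which is nonnegative since
      \<open>e < f\<close>.\<close>
    then have "2 * ?R = 2 * lb_term k r g h + 2 * (int C * (int f - int e))"
      using cH cG False unfolding T hg by (simp add: D C algebra_simps)
    moreover have "0 \<le> int C * (int f - int e)" using False by simp
    moreover have "y \<le> x" if "2 * x = 2 * y + 2 * z" "0 \<le> z" for x y z :: int
      using that by linarith
    ultimately show ?thesis by blast
  qed
qed

text \<open>This is the increment of \<open>h * k - divsum r h\<close>, which makes the bound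
  telescope over an interval.\<close>

lemma lb_term_Suc:
  assumes "0 < r"
  shows "lb_term k r h (Suc h) = k - int (h div r)"
proof (cases "Suc (h mod r) = r")
  case True
  then have "Suc h div r = Suc (h div r)" "Suc h mod r = 0"
    by (simp_all add: div_Suc mod_Suc)
  moreover define q e where "q = h div r" and "e = h mod r"
  ultimately have "lb_term k r h (Suc h) = int r * (k - int (Suc q)) - int e * (k - int (Suc q) - 1) - int e + 1"
    by (simp add: lb_term_def)
  also have "int r = int e + 1" using True by (simp add: e_def)
  finally show ?thesis by (simp add: q_def algebra_simps)
next
  case False
  then have "Suc h div r = h div r" "Suc h mod r = Suc (h mod r)"
    by (simp_all add: div_Suc mod_Suc)
  then show ?thesis by (simp add: lb_term_def)
qed

section \<open>From configurations to sumsets: the lower bound\<close>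

lemma gen_sumset_eq_config_sums:
  assumes "bij_betw a {..<k} A"
  shows "gen_sumset r h A = config_sums k r a h"
proof -
  have S: "(\<Sum>x\<in>A. f x) = (\<Sum>j<k. f (a j))" for f :: "int \<Rightarrow> 'b::comm_monoid_add"
    using sum.reindex_bij_betw[OF assms, of f] by simp
  have ball: "(\<forall>x\<in>A. P x) \<longleftrightarrow> (\<forall>j<k. P (a j))" for P
    using assms by (auto simp: bij_betw_def)
  show ?thesis
  proof (intro equalityI subsetI)
    fix x assume "x \<in> gen_sumset r h A"
    then obtain l where "x = (\<Sum>a\<in>A. int (l a) * a)" "\<forall>a\<in>A. l a \<le> r" "(\<Sum>a\<in>A. l a) = h"
      by (auto simp: gen_sumset_def)
    then have "x = wsum k a (l \<circ> a)" "l \<circ> a \<in> configs k r h"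
      by (simp_all add: wsum_def configs_def S ball)
    then show "x \<in> config_sums k r a h" by (auto simp: config_sums_def)
  next
    fix x assume "x \<in> config_sums k r a h"
    then obtain l where l: "x = wsum k a l" "l \<in> configs k r h" by (auto simp: config_sums_def)
    define l' where "l' = l \<circ> inv_into {..<k} a"
    have l': "l' (a j) = l j" if "j < k" for j
      using assms that by (simp add: l'_def bij_betw_def inv_into_f_f)
    have "x = (\<Sum>a\<in>A. int (l' a) * a)" "\<forall>a\<in>A. l' a \<le> r" "(\<Sum>a\<in>A. l' a) = h"
      using l l' by (simp_all add: S wsum_def configs_def ball)
    then show "x \<in> gen_sumset r h A" by (auto simp: gen_sumset_def)
  qed
qed

text \<open>The second conjunct drives the induction: everything collected so far is at most the
  previous maximum, hence disjoint from the new sums above it.\<close>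

lemma sum_lb_term_le_card:
  assumes "0 < r" and pos: "\<And>j. j < k \<Longrightarrow> 0 < a j"
    and mono: "\<And>j. Suc j < k \<Longrightarrow> a j < a (Suc j)"
    and "\<And>i. i < n \<Longrightarrow> f i < f (Suc i)"
    and "\<And>i. i \<le> n \<Longrightarrow> f i \<le> r * (k - 1)"
  shows "(\<Sum>i=1..n. lb_term (int k) r (f (i - 1)) (f i))
           \<le> int (card (\<Union>i\<in>{1..n}. config_sums k r a (f i)))
         \<and> (\<forall>x\<in>(\<Union>i\<in>{1..n}. config_sums k r a (f i)). x \<le> Max (config_sums k r a (f n)))"
  using assms(4,5)
proof (induction n)
  case (Suc n)
  let ?U = "\<Union>i\<in>{1..n}. config_sums k r a (f i)"
  let ?V = "config_sums k r a (f (Suc n))"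
  let ?M = "Max (config_sums k r a (f n))"
  let ?B = "{x \<in> ?V. ?M < x}"
  have fin: "finite (config_sums k r a h)" for h by (rule finite_config_sums[OF pos])
  have IH: "(\<Sum>i=1..n. lb_term (int k) r (f (i - 1)) (f i)) \<le> int (card ?U)"
    "\<forall>x\<in>?U. x \<le> ?M"
    using Suc by auto
  have lt: "f n < f (Suc n)" using Suc.prems by simp
  note new = card_config_sums_new[where a = a, OF assms(1) pos mono lt Suc.prems(2)[OF le_refl]]
  have U: "(\<Union>i\<in>{1..Suc n}. config_sums k r a (f i)) = ?U \<union> ?V"
    by (auto simp: atLeastAtMostSuc_conv)
  have "lb_term (int k) r (f n) (f (Suc n)) \<le> int (card ?B)"
    using lb_term_le(1)[OF assms(1) less_imp_le[OF lt]] new(2) by (rule order_trans)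
  then have "(\<Sum>i=1..Suc n. lb_term (int k) r (f (i - 1)) (f i)) \<le> int (card ?U + card ?B)"
    using IH(1) by simp
  also have "card ?U + card ?B = card (?U \<union> ?B)"
    using fin IH(2) by (intro card_Un_disjoint[symmetric]) force+
  also have "\<dots> \<le> card (?U \<union> ?V)"
    using fin by (intro card_mono) auto
  finally have "(\<Sum>i=1..Suc n. lb_term (int k) r (f (i - 1)) (f i)) \<le> int (card (?U \<union> ?V))"
    by simp
  moreover have "x \<le> Max ?V" if "x \<in> ?U \<union> ?V" for x
  proof (cases "x \<in> ?V")
    case False
    then have "x \<le> ?M" using that IH(2) by blast
    then show ?thesis using new(1) by simp
  qed (use fin in simp)
  ultimately show ?case unfolding U by blast
qed simp

lemma lower_bound_le:
  assumes "0 < r" and "admissible k r t A H"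
  shows "lower_bound (int k) H r \<le> int (card (gen_sumset_Union r H A))"
proof -
  have A: "finite A" "card A = k" "\<And>a. a \<in> A \<Longrightarrow> 0 < a"
    and H: "finite H" "\<And>h. h \<in> H \<Longrightarrow> 0 < h" and max: "int (Max H) \<le> (int k - 1) * int r - 1"
    using assms(2) by (auto simp: admissible_def)
  define xs where "xs = sorted_list_of_set A"
  define ys where "ys = 0 # sorted_list_of_set H"
  have xs: "sorted_wrt (<) xs" "set xs = A" "length xs = k"
    using A by (simp_all add: xs_def)
  have bij: "bij_betw ((!) xs) {..<k} A"
    using xs bij_betw_nth[of xs "{..<k}" A] by (simp add: strict_sorted_iff)
  have ys: "sorted_wrt (<) ys" "length ys = Suc (card H)"
    using H by (simp_all add: ys_def)
  have f: "hseq H i = ys ! i" for i by (simp add: hseq_def ys_def)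
  have k: "1 \<le> k"
  proof (rule ccontr)
    assume "\<not> 1 \<le> k"
    then have "k = 0" by simp
    then show False using max assms(1) by simp
  qed
  have "int (Max H) < int (r * (k - 1))" using max k by (simp add: of_nat_diff mult.commute)
  then have "Max H \<le> r * (k - 1)" by linarith
  then have le: "h \<le> r * (k - 1)" if "h \<in> H" for h
    using that H(1) by (meson Max_ge le_trans)
  have im: "(\<lambda>i. hseq H i) ` {1..card H} = H"
  proof -
    have "(\<lambda>i. hseq H i) ` {1..card H} = (\<lambda>i. hseq H (Suc i)) ` {..<card H}"
      by (simp add: image_image[symmetric] image_Suc_lessThan)
    also have "\<dots> = set (sorted_list_of_set H)"
      by (auto simp: hseq_def set_conv_nth image_iff)
    finally show ?thesis using H by simp
  qed
  have "(\<Sum>i=1..card H. lb_term (int k) r (hseq H (i - 1)) (hseq H i))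
           \<le> int (card (\<Union>i\<in>{1..card H}. config_sums k r ((!) xs) (hseq H i)))"
  proof (rule conjunct1[OF sum_lb_term_le_card[OF assms(1)]])
    show "0 < xs ! j" if "j < k" for j using A xs that by (metis nth_mem)
    show "xs ! j < xs ! Suc j" if "Suc j < k" for j
      using xs that by (simp add: sorted_wrt_nth_less)
    show "hseq H i < hseq H (Suc i)" if "i < card H" for i
      unfolding f using ys that by (simp add: sorted_wrt_nth_less)
    show "hseq H i \<le> r * (k - 1)" if "i \<le> card H" for i
    proof (cases i)
      case 0
      then show ?thesis by (simp add: hseq_def)
    next
      case (Suc j)
      then have "hseq H i \<in> H" using im that by force
      then show ?thesis by (rule le)
    qed
  qed
  also have "(\<Union>i\<in>{1..card H}. config_sums k r ((!) xs) (hseq H i))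
      = (\<Union>h\<in>(\<lambda>i. hseq H i) ` {1..card H}. config_sums k r ((!) xs) h)" by simp
  also have "\<dots> = gen_sumset_Union r H A"
    unfolding im gen_sumset_Union_def by (simp add: gen_sumset_eq_config_sums[OF bij])
  finally show ?thesis by (simp add: lower_bound_eq)
qed

section \<open>Sharpness: initial segments of the integers and intervals \<open>H\<close>\<close>

text \<open>The pair \<open>(0, s)\<close> gives an exact first summand, because 0 has remainder 0;
  the other pairs are consecutive integers and telescope.\<close>

lemma lower_bound_interval:
  assumes "0 < r" and "0 < s"
  shows "lower_bound k {s..<s + Suc n} r
    = int (s + n) * k - int (divsum r (s + n)) - int (divsum r s) - int s + 1"
proof -
  let ?H = "{s..<s + Suc n}"
  have hs: "hseq ?H 0 = 0" "\<And>i. i \<le> n \<Longrightarrow> hseq ?H (Suc i) = s + i"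
    by (simp_all add: hseq_def del: upt_Suc)
  have "lower_bound k ?H r = (\<Sum>i=0..n. lb_term k r (hseq ?H i) (hseq ?H (Suc i)))"
    unfolding lower_bound_eq
    using sum.shift_bounds_cl_Suc_ivl[of "\<lambda>i. lb_term k r (hseq ?H (i - 1)) (hseq ?H i)" 0 n]
    by (simp del: sum.cl_ivl_Suc)
  also have "\<dots> = lb_term k r 0 s + (\<Sum>i<n. lb_term k r (s + i) (Suc (s + i)))"
    by (simp add: atLeast0AtMost sum.atMost_shift hs[simplified])
  also have "(\<Sum>i<m. lb_term k r (s + i) (Suc (s + i)))
      = int m * k - int (divsum r (s + m)) + int (divsum r s)" for m
    by (induction m) (simp_all add: lb_term_Suc[OF assms(1)] algebra_simps)
  also have "lb_term k r 0 s = int s * (k - 1) - 2 * int (divsum r s) + 1"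
    using lb_term_le(2)[OF assms(1), of 0 s] by simp
  finally show ?thesis by (simp add: algebra_simps)
qed

lemma divsum_mono: "g \<le> h \<Longrightarrow> divsum r g \<le> divsum r h"
  unfolding divsum_def by (rule sum_mono2) auto

text \<open>Each unit step adds \<open>k - n div r\<close>, which is nonnegative as long as
  \<open>n \<le> r * k\<close>.\<close>

lemma top_mono:
  assumes "0 < r" "g \<le> h" "h \<le> r * k"
  shows "int g * int k - int (divsum r g) \<le> int h * int k - int (divsum r h)"
  using assms(2,3)
proof (induction h rule: dec_induct)
  case (step n)
  then have "n div r \<le> k" using assms(1)
    by (metis Suc_leD div_le_mono nonzero_mult_div_cancel_left not_gr_zero)
  then show ?case using step by (simp add: algebra_simps)
qed simp

text \<open>Position \<open>j\<close> carries the element \<open>j + 1\<close>, so a sum is the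
  weight plus \<open>h\<close> and the weight bounds apply.\<close>

lemma gen_sumset_interval:
  assumes "0 < r" and "x \<in> gen_sumset r h {1..int k}"
  shows "int h + int (divsum r h) \<le> x" and "x \<le> int h * int k - int (divsum r h)"
proof -
  have "bij_betw (\<lambda>j. int j + 1) {..<k} {1..int k}"
    by (rule bij_betw_byWitness[where f' = "\<lambda>x. nat (x - 1)"]) auto
  then obtain l where l: "l \<in> configs k r h" "x = wsum k (\<lambda>j. int j + 1) l"
    using assms(2) gen_sumset_eq_config_sums by (auto simp: config_sums_def)
  then have "x = wsum k int l + int h"
    by (simp add: wsum_def configs_def algebra_simps sum.distrib flip: of_nat_sum)
  then show "int h + int (divsum r h) \<le> x" "x \<le> int h * int k - int (divsum r h)"
    using wsum_int_ge[OF assms(1) l(1)] wsum_int_le[OF assms(1) l(1)]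
    by (simp_all add: algebra_simps)
qed

lemma card_gen_sumset_Union_interval_le:
  assumes "0 < r" and "0 < s" and "s + n \<le> r * k"
  shows "int (card (gen_sumset_Union r {s..<s + Suc n} {1..int k}))
           \<le> lower_bound (int k) {s..<s + Suc n} r"
proof -
  let ?lo = "int s + int (divsum r s)" and ?hi = "int (s + n) * int k - int (divsum r (s + n))"
  have "gen_sumset_Union r {s..<s + Suc n} {1..int k} \<subseteq> {?lo..?hi}"
  proof
    fix x assume "x \<in> gen_sumset_Union r {s..<s + Suc n} {1..int k}"
    then obtain h where h: "s \<le> h" "h \<le> s + n" "x \<in> gen_sumset r h {1..int k}"
      by (auto simp: gen_sumset_Union_def)
    have "?lo \<le> int h + int (divsum r h)" using h divsum_mono[of s h r] by simp
    moreover have "int h * int k - int (divsum r h) \<le> ?hi"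
      using top_mono[OF assms(1) h(2) assms(3)] by simp
    ultimately show "x \<in> {?lo..?hi}" using gen_sumset_interval[OF assms(1) h(3)] by simp
  qed
  then have "card (gen_sumset_Union r {s..<s + Suc n} {1..int k}) \<le> card {?lo..?hi}"
    by (intro card_mono) auto
  moreover have "int (card {?lo..?hi}) = lower_bound (int k) {s..<s + Suc n} r"
  proof -
    have "int s * int k - int (divsum r s) \<le> ?hi"
      using top_mono[OF assms(1) _ assms(3), of s] by simp
    \<comment> \<open>An actual configuration of \<open>s\<close> units shows that the enclosing
      interval is nonempty, so its cardinality is \<open>?hi - ?lo + 1\<close> without
      truncation.\<close>
    moreover have "?lo \<le> int s * int k - int (divsum r s)"
    proof -
      obtain l where "l \<in> configs k r s"
        using configs_nonempty[OF assms(1), of s k] assms(3) by auto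
      from wsum_int_ge[OF assms(1) this] wsum_int_le[OF assms(1) this]
      show ?thesis by (simp add: algebra_simps)
    qed
    ultimately show ?thesis unfolding lower_bound_interval[OF assms(1,2)] by simp
  qed
  ultimately show ?thesis by linarith
qed

theorem theorem2p1:
  fixes k r t :: nat
  assumes "3 \<le> k" and "1 \<le> r" and "2 \<le> t"
  shows "(\<forall>A H. admissible k r t A H \<longrightarrow>
            lower_bound (int k) H r \<le> int (card (gen_sumset_Union r H A)))
       \<and> (int t \<le> (int k - 1) * int r - 1 \<longrightarrow>
            (\<exists>A H. admissible k r t A H \<and>
                   int (card (gen_sumset_Union r H A)) = lower_bound (int k) H r))"
proof (intro conjI allI impI)
  have r: "0 < r" using assms(2) by simp
  show "lower_bound (int k) H r \<le> int (card (gen_sumset_Union r H A))"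
    if "admissible k r t A H" for A H
    using lower_bound_le[OF r that] .
  assume t: "int t \<le> (int k - 1) * int r - 1"
  obtain n where n: "t = Suc n" using assms(3) by (cases t) auto
  \<comment> \<open>With this \<open>s\<close> the interval of \<open>t\<close> integers ends at
    \<open>(k - 1) * r - 1\<close>, the largest value allowed for \<open>Max H\<close>.\<close>
  define s where "s = (k - 1) * r - t"
  have "int ((k - 1) * r) = (int k - 1) * int r" using assms(1) by (simp add: of_nat_diff)
  then have kr: "int s + int t = (int k - 1) * int r" and s: "0 < s"
    using t unfolding s_def by linarith+
  \<comment> \<open>From \<open>3 \<le> k\<close>: the maximum \<open>(k - 1) * r - 1\<close> is at
    least \<open>2 * r - 1\<close>, hence at least \<open>r\<close>.\<close>
  have "2 * int r \<le> (int k - 1) * int r" using assms(1) by (intro mult_right_mono) auto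
  then have rs: "r \<le> s + n" using kr n assms(2) by linarith
  have "(int k - 1) * int r \<le> int r * int k" by (simp add: algebra_simps)
  then have "int (s + n) \<le> int (r * k)" using kr n by simp
  then have le: "s + n \<le> r * k" by linarith
  let ?A = "{1..int k}" and ?H = "{s..<s + Suc n}"
  have "Max ?H = s + n" by (rule Max_eqI) auto
  then have adm: "admissible k r t ?A ?H"
    using rs kr s n by (auto simp: admissible_def)
  then show "\<exists>A H. admissible k r t A H \<and>
                   int (card (gen_sumset_Union r H A)) = lower_bound (int k) H r"
    using lower_bound_le[OF r adm] card_gen_sumset_Union_interval_le[OF r s le] by force
qed

end
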